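(* Let $\mu\subseteq(m^n)$ be a partition and let $\beta\in\mathbb N^n$. Set $\overline\beta=\omega_n\beta$. Then $\beta_\mu$ exists if and only if $\overline\beta\in\operatorname{Comp}(\mu^\vee)$. When this condition holds, apply the parking construction to the pair $(\overline\beta,\mu^\vee)$, obtaining $\overline\beta^{\,\mu^\vee}\in\mathbb N^m$. Then $$\beta_\mu=\omega_m\!\left(\overline\beta^{\,\mu^\vee}\right).$$ Thus the lower transform associated with the inner boundary $\mu$ is computed by reversing the indexing composition, applying the same parking construction used for an upper Ferrers boundary, and finally reversing the output.
   Context: $\mathbb N=\{0,1,2,\ldots\}$; $\omega_r(a_1,\ldots,a_r)=(a_r,\ldots,a_1)$; partitions contained in $(m^n)$ are regarded as having $n$ parts by appending zeros; $\mu^\vee=(m-\mu_n,m-\mu_{n-1},\ldots,m-\mu_1)$. For a weak composition $\alpha$, $\alpha^+$ is its weakly decreasing rearrangement and $K(\alpha)$ is the key tableau: the semistandard tableau (English notation) of shape $\alpha^+$ and content $\alpha$ (column $r$ is $\{i:\alpha_i\ge r\}$). Let $\kappa\subseteq(m^n)$ be a partition and $\alpha\in\mathbb N^n$. $B_+^\kappa(\alpha)$ is the filling of shape $\alpha^+$ such that, if column $r$ has length $c_r$, its $i$-th entry from the top is $\kappa_p$, where $p$ is the $(c_r+1-i)$-th entry from the top of column $r$ of $K(\alpha)$. For a weakly increasing integer column written from bottom to top as $c_1\ge\cdots\ge c_k$, its strictification is the column $d_1>\cdots>d_k$ (bottom to top) with $d_1=c_1$, $d_i=\min\{d_{i-1}-1,c_i\}$.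 If the columnwise strictification of $B_+^\kappa(\alpha)$ has only positive entries (vacuously true for $\alpha=0$), it is a key tableau and $\alpha^\kappa\in\mathbb N^m$ (trailing zeros appended if necessary) is the weak composition with $K(\alpha^\kappa)=\operatorname{str}(B_+^\kappa(\alpha))$; otherwise $\alpha^\kappa$ does not exist. $\operatorname{Comp}(\kappa)=\{\alpha\in\mathbb N^n:\alpha^\kappa\text{ exists}\}$. The lower transform is $\beta_\mu:=\omega_m\bigl((\omega_n\beta)^{\mu^\vee}\bigr)\in\mathbb N^m$, which exists when the right-hand side is defined. Parking construction for a pair $(\alpha,\kappa)$: if $\alpha=0$, return $0^m$. Otherwise order the support of $\alpha$ as $i_1,\ldots,i_c$ with $\alpha_{i_1}\ge\cdots\ge\alpha_{i_c}>0$ (ties broken arbitrarily); at step $t$ let $q_t=\max(\{1,\ldots,\kappa_{i_t}\}\setminus\{q_1,\ldots,q_{t-1}\})$, failing if the set is empty, and place the part $\alpha_{i_t}$ in position $q_t$; if all steps succeed, the output is the composition in $\mathbb N^m$ whose $q_t$-th entry is $\alpha_{i_t}$ for $1\le t\le c$ and whose other entries are $0$. *)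

theory Defs
  imports Main
begin

text \<open>
  Compositions, partitions and tableau columns are lists. The indices of their entries
  run from 1, as the entries of a key tableau are themselves such indices.
\<close>

definition part :: "nat list \<Rightarrow> nat \<Rightarrow> nat" where
  "part \<alpha> i = \<alpha> ! (i - 1)"

definition support :: "nat list \<Rightarrow> nat set" where
  "support \<alpha> = {i \<in> {1..length \<alpha>}. part \<alpha> i > 0}"

text \<open>Partitions contained in the rectangle with \<open>n\<close> rows of length \<open>m\<close>, zero parts included.\<close>

definition box_partition :: "nat \<Rightarrow> nat \<Rightarrow> nat list \<Rightarrow> bool" where
  "box_partition n m \<mu> \<longleftrightarrow>
     length \<mu> = n \<and> sorted_wrt (\<ge>) \<mu> \<and> (\<forall>x \<in> set \<mu>. x \<le> m)"

definition box_complement :: "nat \<Rightarrow> nat list \<Rightarrow> nat list" where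
  "box_complement m \<mu> = map (\<lambda>x. m - x) (rev \<mu>)"

text \<open>
  A filling is the list of its columns from left to right, each column being listed from
  top to bottom; its shape is determined by the column lengths.
\<close>

definition key_column :: "nat list \<Rightarrow> nat \<Rightarrow> nat list" where
  "key_column \<alpha> r = sorted_list_of_set {i \<in> {1..length \<alpha>}. part \<alpha> i \<ge> r}"

definition key_tableau :: "nat list \<Rightarrow> nat list list" where
  "key_tableau \<alpha> = map (key_column \<alpha>) [1..<Suc (Max (insert 0 (set \<alpha>)))]"

definition boundary_filling :: "nat list \<Rightarrow> nat list \<Rightarrow> int list list" where
  "boundary_filling \<kappa> \<alpha> =
     map (\<lambda>col. map (\<lambda>p. int (part \<kappa> p)) (rev col)) (key_tableau \<alpha>)"

text \<open>
  The argument lists \<open>c\<^sub>1 \<ge> \<dots> \<ge> c\<^sub>k\<close> from bottom to top. Lowering the second entry to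
  \<open>d\<^sub>2 = min (d\<^sub>1 - 1) c\<^sub>2\<close> before recursing gives \<open>d\<^sub>i = min (d\<^sub>i\<^sub>-\<^sub>1 - 1) c\<^sub>i\<close> throughout.
\<close>

fun strictify :: "int list \<Rightarrow> int list" where
  "strictify [] = []"
| "strictify [c] = [c]"
| "strictify (c # c' # cs) = c # strictify (min (c - 1) c' # cs)"

definition column_str :: "int list list \<Rightarrow> int list list" where
  "column_str F = map (\<lambda>col. rev (strictify (rev col))) F"

text \<open>The result \<open>None\<close> means that the transform does not exist.\<close>

definition upper_transform :: "nat \<Rightarrow> nat list \<Rightarrow> nat list \<Rightarrow> nat list option" where
  "upper_transform m \<kappa> \<alpha> =
     (if \<forall>col \<in> set (column_str (boundary_filling \<kappa> \<alpha>)). \<forall>x \<in> set col. x > 0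
      then Some (THE \<gamma>. length \<gamma> = m \<and>
             map (map int) (key_tableau \<gamma>) = column_str (boundary_filling \<kappa> \<alpha>))
      else None)"

definition Comp :: "nat \<Rightarrow> nat \<Rightarrow> nat list \<Rightarrow> nat list set" where
  "Comp n m \<kappa> = {\<alpha>. length \<alpha> = n \<and> upper_transform m \<kappa> \<alpha> \<noteq> None}"

definition lower_transform :: "nat \<Rightarrow> nat list \<Rightarrow> nat list \<Rightarrow> nat list option" where
  "lower_transform m \<mu> \<beta> = map_option rev (upper_transform m (box_complement m \<mu>) (rev \<beta>))"

definition parking_order :: "nat list \<Rightarrow> nat list \<Rightarrow> bool" where
  "parking_order \<alpha> is \<longleftrightarrow>
     distinct is \<and> set is = support \<alpha> \<and> sorted_wrt (\<lambda>i j. part \<alpha> i \<ge> part \<alpha> j) is"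

text \<open>\<open>Q\<close> is the set of positions already taken.\<close>

fun park_positions :: "nat list \<Rightarrow> nat set \<Rightarrow> nat list \<Rightarrow> nat list option" where
  "park_positions \<kappa> Q [] = Some []"
| "park_positions \<kappa> Q (i # is) =
     (let free = {1..part \<kappa> i} - Q in
      if free = {} then None
      else map_option (\<lambda>qs. Max free # qs) (park_positions \<kappa> (insert (Max free) Q) is))"

definition place_parts :: "nat \<Rightarrow> (nat \<times> nat) list \<Rightarrow> nat list" where
  "place_parts m qas =
     map (\<lambda>q. case map_of qas q of None \<Rightarrow> 0 | Some a \<Rightarrow> a) [1..<Suc m]"

definition parking_run :: "nat \<Rightarrow> nat list \<Rightarrow> nat list \<Rightarrow> nat list \<Rightarrow> nat list option" where
  "parking_run m \<kappa> \<alpha> is =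
     map_option (\<lambda>qs. place_parts m (zip qs (map (part \<alpha>) is))) (park_positions \<kappa> {} is)"

text \<open>
  All results of the parking construction, over all ways of breaking ties. The zero
  composition has empty support, so its only result is the zero composition.
\<close>

definition parking_outcomes :: "nat \<Rightarrow> nat list \<Rightarrow> nat list \<Rightarrow> nat list option set" where
  "parking_outcomes m \<kappa> \<alpha> = {parking_run m \<kappa> \<alpha> is | is. parking_order \<alpha> is}"

text \<open>
  The columns above do form the semistandard tableau whose shape is the weakly decreasing
  rearrangement of \<open>\<alpha>\<close> and whose content is \<open>\<alpha>\<close>.
\<close>

lemma key_tableau_nth:
  "r < length (key_tableau \<alpha>) \<Longrightarrow> key_tableau \<alpha> ! r = key_column \<alpha> (Suc r)"
  unfolding key_tableau_def by (simp del: upt_Suc)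

lemma length_key_column:
  "length (key_column \<alpha> r) = length (filter (\<lambda>a. a \<ge> r) (rev (sort \<alpha>)))"
proof -
  have "{i \<in> {1..length \<alpha>}. part \<alpha> i \<ge> r} = Suc ` {i. i < length \<alpha> \<and> \<alpha> ! i \<ge> r}"
    unfolding part_def
    by (auto simp: image_iff) (metis Suc_le_eq Suc_pred diff_Suc_1)
  then have "length (key_column \<alpha> r) = card {i. i < length \<alpha> \<and> \<alpha> ! i \<ge> r}"
    unfolding key_column_def by (simp add: card_image)
  also have "\<dots> = length (filter (\<lambda>a. a \<ge> r) \<alpha>)"
    by (simp add: length_filter_conv_card)
  also have "\<dots> = length (filter (\<lambda>a. a \<ge> r) (rev (sort \<alpha>)))"
    by (simp add: rev_filter[symmetric] filter_sort)
  finally show ?thesis .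
qed

lemma length_key_tableau:
  "length (key_tableau \<alpha>) = (case rev (sort \<alpha>) of [] \<Rightarrow> 0 | a # _ \<Rightarrow> a)"
proof (cases "rev (sort \<alpha>)")
  case Nil
  then have "\<alpha> = []" by (metis length_0_conv length_rev length_sort)
  then show ?thesis by (simp add: key_tableau_def)
next
  case (Cons a as)
  have "sorted_wrt (\<ge>) (rev (sort \<alpha>))"
    by (simp add: sorted_wrt_rev)
  moreover have "set (rev (sort \<alpha>)) = set \<alpha>" by simp
  ultimately have "set \<alpha> = insert a (set as)" "\<forall>x \<in> set as. x \<le> a"
    using Cons by auto
  then have "Max (insert 0 (set \<alpha>)) = a"
    by (intro Max_eqI) auto
  then show ?thesis using Cons by (simp add: key_tableau_def)
qed

lemma key_column_strict: "sorted_wrt (<) (key_column \<alpha> r)"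
  unfolding key_column_def by simp

lemma sorted_list_of_set_nth_antimono:
  fixes A B :: "nat set"
  assumes "finite A" "B \<subseteq> A" "k < card B"
  shows "sorted_list_of_set A ! k \<le> sorted_list_of_set B ! k"
proof (rule ccontr)
  let ?a = "sorted_list_of_set A" and ?b = "sorted_list_of_set B"
  assume "\<not> ?a ! k \<le> ?b ! k"
  then have lt: "?b ! k < ?a ! k" by simp
  have fB: "finite B" using assms finite_subset by blast
  have "k < length ?b" using assms by simp
  have "(!) ?b ` {..k} \<subseteq> (!) ?a ` {..<k}"
  proof
    fix x assume "x \<in> (!) ?b ` {..k}"
    then obtain j where j: "j \<le> k" "x = ?b ! j" by auto
    have "x \<le> ?b ! k"
      using j \<open>k < length ?b\<close> sorted_nth_mono[OF sorted_sorted_list_of_set] by metis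
    then have xlt: "x < ?a ! k" using lt by simp
    have "x \<in> set ?b" using j \<open>k < length ?b\<close> by (simp del: set_sorted_list_of_set)
    then have "x \<in> set ?a" using assms fB by auto
    then obtain i where i: "i < length ?a" "x = ?a ! i" by (metis in_set_conv_nth)
    have "i < k"
    proof (rule ccontr)
      assume "\<not> i < k"
      then have "?a ! k \<le> ?a ! i"
        using i sorted_nth_mono[OF sorted_sorted_list_of_set] by (metis not_le)
      then show False using xlt i by simp
    qed
    then show "x \<in> (!) ?a ` {..<k}" using i by auto
  qed
  then have "card ((!) ?b ` {..k}) \<le> card ((!) ?a ` {..<k})"
    by (intro card_mono) auto
  also have "\<dots> \<le> k" using card_image_le[of "{..<k}" "(!) ?a"] by simp
  finally have "card ((!) ?b ` {..k}) \<le> k" .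
  moreover have "inj_on ((!) ?b) {..k}"
    using \<open>k < length ?b\<close> by (intro inj_on_nth) auto
  ultimately show False by (simp add: card_image)
qed

lemma key_tableau_row_weak:
  assumes "r \<le> s" "k < length (key_column \<alpha> s)"
  shows "key_column \<alpha> r ! k \<le> key_column \<alpha> s ! k"
  using assms unfolding key_column_def
  by (intro sorted_list_of_set_nth_antimono) auto

lemma count_list_distinct: "distinct xs \<Longrightarrow> count_list xs x = (if x \<in> set xs then 1 else 0)"
  by (induction xs) auto

lemma key_tableau_content:
  assumes "i \<in> {1..length \<alpha>}"
  shows "count_list (concat (key_tableau \<alpha>)) i = part \<alpha> i"
proof -
  have cnt: "count_list (key_column \<alpha> r) i = (if part \<alpha> i \<ge> r then 1 else 0)" for r
  proof -
    have "distinct (key_column \<alpha> r)" "set (key_column \<alpha> r) = {i \<in> {1..length \<alpha>}. part \<alpha> i \<ge> r}"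
      unfolding key_column_def by auto
    then show ?thesis using assms
      count_list_distinct[of "key_column \<alpha> r" i] by auto
  qed
  have sum: "count_list (concat (map (key_column \<alpha>) [1..<Suc M])) i = min M (part \<alpha> i)" for M
    by (induction M) (auto simp: cnt)
  have "part \<alpha> i \<in> set \<alpha>" using assms unfolding part_def by auto
  then have "part \<alpha> i \<le> Max (insert 0 (set \<alpha>))" by simp
  then show ?thesis unfolding key_tableau_def sum by simp
qed

end

theory Submission
  imports Defs "HOL-Library.Multiset"
begin

text \<open>
  The parking construction and strictification are the same greedy procedure, run on the
  same cars in different orders. Let a car of capacity \<open>c\<close> take the largest free position in
  \<open>{1..c}\<close>. If cars arrive in order of weakly decreasing capacity, the next one parks directly
  below the last one or at its own capacity, whichever is lower, because the positions in
  between are filled without gaps; this is the recursion that defines strictification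
  (\<open>strictify_eq_park\<close>). On the other hand two consecutive arrivals can be exchanged without
  changing the set of occupied positions (\<open>park_commute\<close>), so this set depends only on which
  cars have arrived (\<open>fold_park_order_independent\<close>).

  Column \<open>r\<close> of the key tableau of \<open>\<alpha>\<close> lists the rows whose part is at least \<open>r\<close>. In the parking
  construction, these rows are the first ones to park, however ties are broken. Hence the
  positions that they occupy are the entries of the strictified column \<open>r\<close>, and they are exactly the
  positions that receive a part at least \<open>r\<close>. So the key tableau of the parking outcome is the
  strictified filling, and a composition of given length is determined by its key tableau.
  The lower transform is, by definition, the reversal of the upper transform of the reversed
  composition at the complementary boundary, so the result for upper boundaries transfers.
\<close>

section \<open>Greedy parking\<close>

text \<open>
  Position 0 collects the cars that find no free position. This makes parking total, so that
  it can be studied as a fold of commuting operations; failure is the event that 0 is occupied.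
\<close>

definition spot :: "nat \<Rightarrow> nat set \<Rightarrow> nat" where
  "spot c Q = Max (insert 0 ({1..c} - Q))"

definition park :: "nat \<Rightarrow> nat set \<Rightarrow> nat set" where
  "park c Q = insert (spot c Q) Q"

lemma spot_eqI:
  assumes "s \<le> c" "s = 0 \<or> s \<notin> Q" "{s<..c} \<subseteq> Q"
  shows "spot c Q = s"
  unfolding spot_def
proof (rule Max_eqI)
  show "y \<le> s" if "y \<in> insert 0 ({1..c} - Q)" for y
  proof (rule ccontr)
    assume "\<not> y \<le> s"
    then have "y \<in> {s<..c}" "y \<notin> Q" using that by auto
    then show False using assms(3) by blast
  qed
  show "s \<in> insert 0 ({1..c} - Q)" using assms(1,2) by (cases s) auto
qed simp

lemma spot_props: "spot c Q \<le> c" "spot c Q = 0 \<or> spot c Q \<notin> Q" "{spot c Q<..c} \<subseteq> Q"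
proof -
  have "spot c Q \<in> insert 0 ({1..c} - Q)"
    unfolding spot_def by (rule Max_in) auto
  then show "spot c Q \<le> c" "spot c Q = 0 \<or> spot c Q \<notin> Q" by auto
  show "{spot c Q<..c} \<subseteq> Q"
  proof
    fix y assume y: "y \<in> {spot c Q<..c}"
    show "y \<in> Q"
    proof (rule ccontr)
      assume "y \<notin> Q"
      then have "y \<le> spot c Q"
        unfolding spot_def using y by (intro Max_ge) auto
      then show False using y by simp
    qed
  qed
qed

text \<open>
  If the two cars want different positions, the larger one is out of reach of the smaller car, so
  neither disturbs the other. If they want the same position, all positions between their two
  capacities are occupied, so the two cars are interchangeable.
\<close>

lemma park_commute: "park c (park d Q) = park d (park c Q)"
proof -
  have *: "park c (park d Q) = park d (park c Q)" if "c \<le> d" for c d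
  proof (cases "spot c Q = spot d Q")
    case True
    let ?s = "spot d Q" and ?Q = "insert (spot d Q) Q"
    have "{spot c ?Q<..d} \<subseteq> ?Q"
    proof
      fix y assume y: "y \<in> {spot c ?Q<..d}"
      show "y \<in> ?Q"
      proof (cases "y \<le> c")
        case True
        then show ?thesis using y spot_props(3)[of c ?Q] by auto
      next
        case False
        then have "y \<in> {?s<..d}" using y spot_props(1)[of c Q] True by simp
        then show ?thesis using spot_props(3)[of d Q] by blast
      qed
    qed
    then have "spot d ?Q = spot c ?Q"
      using spot_props(1,2)[of c ?Q] that by (intro spot_eqI) auto
    then show ?thesis unfolding park_def using True by simp
  next
    case False
    have less: "spot c Q < spot d Q"
    proof (rule ccontr)
      assume "\<not> spot c Q < spot d Q"
      then have "spot c Q \<in> {spot d Q<..d}"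
        using False that spot_props(1)[of c Q] by simp
      then show False using spot_props(2)[of c Q] spot_props(3)[of d Q]
        \<open>\<not> spot c Q < spot d Q\<close> False by fastforce
    qed
    have "c < spot d Q"
      using less spot_props(2)[of d Q] spot_props(3)[of c Q] by (metis greaterThanAtMost_iff
        less_zeroE linorder_not_less subsetD)
    then have "spot c (insert (spot d Q) Q) = spot c Q"
      using spot_props[of c Q] by (intro spot_eqI) auto
    moreover have "spot d (insert (spot c Q) Q) = spot d Q"
      using spot_props[of d Q] less by (intro spot_eqI) auto
    ultimately show ?thesis unfolding park_def by auto
  qed
  show ?thesis using *[of c d] *[of d c] by (cases "c \<le> d") auto
qed

lemma fold_park_order_independent:
  assumes "distinct xs" "distinct ys" "set xs = set ys"
  shows "fold park (map f xs) Q = fold park (map f ys) Q"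
proof -
  have "mset xs = mset ys" using assms set_eq_iff_mset_eq_distinct by blast
  then have "fold park (map f xs) = fold park (map f ys)"
    by (intro fold_multiset_equiv) (auto simp: park_commute fun_eq_iff)
  then show ?thesis by simp
qed

lemma fold_park_superset: "Q \<subseteq> fold park cs Q"
proof (induction cs arbitrary: Q)
  case (Cons c cs)
  have "Q \<subseteq> park c Q" by (auto simp: park_def)
  then show ?case using Cons.IH[of "park c Q"] by simp
qed simp

section \<open>Strictification as greedy parking\<close>

text \<open>
  The number \<open>e\<close> is the capacity \<open>x\<close> of the next car after strictification has lowered it. The
  hypotheses say that the cars already parked fill the gap between \<open>e\<close> and \<open>x\<close> and leave
  everything below free, so that \<open>e\<close> is the position where the car parks.
\<close>

lemma strictify_eq_park_aux:
  assumes "sorted_wrt (\<ge>) (x # cs)" "e \<le> x" "{e<..x} \<subseteq> Q" "Q \<inter> {1..e} = {}"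
    and "\<forall>y \<in> set (strictify (int e # map int cs)). y > 0"
  shows "int ` fold park (x # cs) Q = int ` Q \<union> set (strictify (int e # map int cs))"
  using assms
proof (induction cs arbitrary: x e Q)
  case Nil
  then have "spot x Q = e" by (intro spot_eqI) auto
  then show ?case by (simp add: park_def)
next
  case (Cons c cs)
  have e: "e > 0" using Cons.prems(5) by simp
  have "spot x Q = e" using Cons.prems e by (intro spot_eqI) auto
  then have park: "park x Q = insert e Q" by (simp add: park_def)
  let ?e = "min (e - 1) c"
  have low: "min (int e - 1) (int c) = int ?e" using e by linarith
  have "int ` fold park (c # cs) (insert e Q)
      = int ` insert e Q \<union> set (strictify (int ?e # map int cs))"
  proof (rule Cons.IH)
    show "{?e<..c} \<subseteq> insert e Q"
    proof
      fix y assume y: "y \<in> {?e<..c}"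
      then have "e \<le> y" "y \<le> x" using Cons.prems(1) by auto
      then show "y \<in> insert e Q" using Cons.prems(3) by (cases "y = e") auto
    qed
    have "{1..?e} \<subseteq> {1..e}" "e \<notin> {1..?e}" using e by auto
    then show "insert e Q \<inter> {1..?e} = {}" using Cons.prems(4) by blast
    show "\<forall>y \<in> set (strictify (int ?e # map int cs)). y > 0"
      using Cons.prems(5) unfolding list.map strictify.simps low by simp
  qed (use Cons.prems(1) in auto)
  then show ?case unfolding list.map strictify.simps low by (simp add: park)
qed

lemma strictify_eq_park:
  assumes "sorted_wrt (\<ge>) cs" "\<forall>y \<in> set (strictify (map int cs)). y > 0"
  shows "set (strictify (map int cs)) = int ` fold park cs {}"
proof (cases cs)
  case (Cons x xs)
  then show ?thesis using strictify_eq_park_aux[of x xs x "{}"] assms by simp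
qed simp

lemma strictify_decreasing:
  "sorted_wrt (>) (strictify xs) \<and> (\<forall>y \<in> set (strictify xs). y \<le> hd xs)"
proof (induction xs rule: strictify.induct)
  case (3 c c' cs)
  have "y < c" if "y \<in> set (strictify (min (c - 1) c' # cs))" for y
  proof -
    have "y \<le> min (c - 1) c'" using 3 that unfolding list.sel by blast
    then show ?thesis by simp
  qed
  then show ?case by (simp add: 3) (meson less_imp_le)
qed simp_all

text \<open>
  A strictified column is strictly monotone, so its underlying set determines it.
\<close>

lemma rev_strictify_eq_sorted_list:
  assumes "sorted_wrt (\<ge>) cs" "\<forall>y \<in> set (strictify (map int cs)). y > 0"
    and "fold park cs {} = S"
  shows "rev (strictify (map int cs)) = map int (sorted_list_of_set S)"
proof (rule sorted_distinct_set_unique)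
  have "sorted_wrt (<) (rev (strictify (map int cs)))"
    using strictify_decreasing[of "map int cs"] by (simp add: sorted_wrt_rev)
  then show "sorted (rev (strictify (map int cs)))" "distinct (rev (strictify (map int cs)))"
    unfolding strict_sorted_iff by auto
  show "sorted (map int (sorted_list_of_set S))"
    by (simp add: sorted_map sorted_wrt_mono_rel[OF _ sorted_sorted_list_of_set])
  show "distinct (map int (sorted_list_of_set S))" by (simp add: distinct_map)
  have S: "set (strictify (map int cs)) = int ` S"
    using strictify_eq_park[OF assms(1,2)] assms(3) by simp
  then have "finite S" using finite_imageD[of int S] by (metis List.finite_set inj_on_of_nat)
  then show "set (rev (strictify (map int cs))) = set (map int (sorted_list_of_set S))"
    using S by simp
qed

section \<open>The parking construction\<close>

lemma park_positions_take:
  "park_positions \<kappa> Q is = Some qs \<Longrightarrow>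
    park_positions \<kappa> Q (take k is) = Some (take k qs)"
proof (induction "is" arbitrary: Q qs k)
  case (Cons i "is")
  then show ?case by (cases k) (auto simp: Let_def split: if_splits)
qed simp

lemma park_positions_Some:
  assumes "park_positions \<kappa> Q is = Some qs"
  shows "length qs = length is" "fold park (map (part \<kappa>) is) Q = Q \<union> set qs"
    and "distinct qs" "set qs \<inter> Q = {}" "\<forall>q \<in> set qs. \<exists>i \<in> set is. q \<in> {1..part \<kappa> i}"
proof -
  have "length qs = length is \<and> fold park (map (part \<kappa>) is) Q = Q \<union> set qs \<and> distinct qs
    \<and> set qs \<inter> Q = {} \<and> (\<forall>q \<in> set qs. \<exists>i \<in> set is. q \<in> {1..part \<kappa> i})"
    using assms
  proof (induction "is" arbitrary: Q qs)
    case (Cons i "is")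
    let ?free = "{1..part \<kappa> i} - Q"
    from Cons.prems obtain qs' where free: "?free \<noteq> {}" and qs: "qs = Max ?free # qs'"
      and rest: "park_positions \<kappa> (insert (Max ?free) Q) is = Some qs'"
      by (auto simp: Let_def split: if_splits)
    have "spot (part \<kappa> i) Q = Max ?free"
      unfolding spot_def using free by (simp add: Max_insert)
    moreover have "Max ?free \<in> ?free" using free by (intro Max_in) auto
    ultimately show ?case using Cons.IH[OF rest] by (auto simp: qs park_def)
  qed simp
  then show "length qs = length is" "fold park (map (part \<kappa>) is) Q = Q \<union> set qs"
    and "distinct qs" "set qs \<inter> Q = {}" "\<forall>q \<in> set qs. \<exists>i \<in> set is. q \<in> {1..part \<kappa> i}"
    by blast+
qed

lemma park_positions_succeeds:
  "0 \<notin> fold park (map (part \<kappa>) is) Q \<Longrightarrow> park_positions \<kappa> Q is \<noteq> None"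
proof (induction "is" arbitrary: Q)
  case (Cons i "is")
  let ?free = "{1..part \<kappa> i} - Q"
  have "spot (part \<kappa> i) Q \<in> park (part \<kappa> i) Q" by (simp add: park_def)
  then have "spot (part \<kappa> i) Q \<noteq> 0"
    using Cons.prems fold_park_superset[of "park (part \<kappa> i) Q" "map (part \<kappa>) is"]
    by (metis fold_simps(2) list.map(2) subsetD)
  then have free: "?free \<noteq> {}" unfolding spot_def by (metis Max_singleton)
  then have "spot (part \<kappa> i) Q = Max ?free"
    unfolding spot_def by (simp add: Max_insert)
  then have "park_positions \<kappa> (insert (Max ?free) Q) is \<noteq> None"
    using Cons.IH[of "park (part \<kappa> i) Q"] Cons.prems unfolding park_def[of "part \<kappa> i" Q]
    by (simp add: park_def[of "part \<kappa> i" Q])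
  then show ?case using free by (auto simp: Let_def)
qed simp

lemma part_place_parts:
  assumes "distinct qs" "length qs = length as" "q \<in> {1..m}"
  shows "q \<notin> set qs \<Longrightarrow> part (place_parts m (zip qs as)) q = 0"
    and "k < length qs \<Longrightarrow> q = qs ! k \<Longrightarrow> part (place_parts m (zip qs as)) q = as ! k"
proof -
  have nth: "part (place_parts m (zip qs as)) q
      = (case map_of (zip qs as) q of None \<Rightarrow> 0 | Some a \<Rightarrow> a)"
  proof -
    have "q - 1 < length [1..<Suc m]" "[1..<Suc m] ! (q - 1) = q"
      using assms(3) by (auto simp del: upt_Suc simp: nth_upt)
    then show ?thesis unfolding Defs.part_def place_parts_def by (simp del: upt_Suc)
  qed
  show "part (place_parts m (zip qs as)) q = 0" if "q \<notin> set qs"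
  proof -
    have "map_of (zip qs as) q = None" using that assms(2) by (simp add: map_of_zip_is_None)
    then show ?thesis unfolding nth by simp
  qed
  show "part (place_parts m (zip qs as)) q = as ! k" if "k < length qs" "q = qs ! k"
    unfolding nth using that assms(1,2) by (simp add: map_of_zip_nth)
qed

lemma part_in_set: "i \<in> {1..length \<alpha>} \<Longrightarrow> part \<alpha> i \<in> set \<alpha>"
  unfolding Defs.part_def by auto

lemma set_conv_part: "set \<alpha> = part \<alpha> ` {1..length \<alpha>}"
proof
  show "set \<alpha> \<subseteq> part \<alpha> ` {1..length \<alpha>}"
  proof
    fix x assume "x \<in> set \<alpha>"
    then obtain k where "k < length \<alpha>" "x = \<alpha> ! k" by (metis in_set_conv_nth)
    then have "Suc k \<in> {1..length \<alpha>}" "x = part \<alpha> (Suc k)" by (auto simp: Defs.part_def)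
    then show "x \<in> part \<alpha> ` {1..length \<alpha>}" by blast
  qed
qed (auto intro: part_in_set)

lemma insert_zero_set_conv_support: "insert 0 (set \<alpha>) = insert 0 (part \<alpha> ` support \<alpha>)"
  unfolding set_conv_part support_def by auto

lemma parking_order_exists: "\<exists>is. parking_order \<alpha> is"
proof
  have "finite (support \<alpha>)" unfolding support_def by simp
  then show "parking_order \<alpha> (rev (sort_key (part \<alpha>) (sorted_list_of_set (support \<alpha>))))"
    unfolding parking_order_def
    using sorted_sort_key[of "part \<alpha>" "sorted_list_of_set (support \<alpha>)"]
    by (simp add: sorted_wrt_rev sorted_map)
qed

text \<open>
  A parking order visits the parts in weakly decreasing order, so it runs through the columns of the
  key tableau from right to left, finishing each column before it enters the next. Ties
  are broken only inside the difference of two consecutive columns.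
\<close>

lemma parking_order_prefix:
  assumes "parking_order \<alpha> is" "r > 0"
  obtains k where "set (take k is) = {i \<in> {1..length \<alpha>}. part \<alpha> i \<ge> r}"
    "\<And>j. j < length is \<Longrightarrow> part \<alpha> (is ! j) \<ge> r \<longleftrightarrow> j < k"
proof -
  let ?P = "\<lambda>i. part \<alpha> i \<ge> r"
  define k where "k = length (takeWhile ?P is)"
  have iff: "?P (is ! j) \<longleftrightarrow> j < k" if j: "j < length is" for j
  proof
    show "?P (is ! j)" if "j < k"
    proof -
      have "takeWhile ?P is ! j \<in> set (takeWhile ?P is)"
        using that unfolding k_def by (rule nth_mem)
      then show ?thesis using that takeWhile_nth[of j ?P "is"] set_takeWhileD[of _ ?P "is"]
        unfolding k_def by simp
    qed
    show "j < k" if "?P (is ! j)"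
    proof (rule ccontr)
      assume "\<not> j < k"
      then have "k \<le> j" "k < length is" using j by simp_all
      then have "\<not> ?P (is ! k)"
        using nth_length_takeWhile[of ?P "is"] unfolding k_def by blast
      moreover have "part \<alpha> (is ! k) \<ge> part \<alpha> (is ! j)"
      proof (cases "k = j")
        case False
        then have "k < j" using \<open>k \<le> j\<close> by simp
        then show ?thesis
          using assms(1) j unfolding parking_order_def sorted_wrt_iff_nth_less by blast
      qed simp
      ultimately show False using that by simp
    qed
  qed
  have "set is = support \<alpha>" using assms(1) unfolding parking_order_def by simp
  moreover have "set (take k is) = {i \<in> set is. ?P i}"
  proof (intro equalityI subsetI)
    fix i assume "i \<in> set (take k is)"
    then have "i \<in> set (takeWhile ?P is)" unfolding k_def takeWhile_eq_take[symmetric] .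
    then show "i \<in> {i \<in> set is. ?P i}" using set_takeWhileD[of i ?P "is"] by simp
  next
    fix i assume i: "i \<in> {i \<in> set is. ?P i}"
    then obtain j where j: "j < length is" "i = is ! j" by (auto simp: in_set_conv_nth)
    then have "j < k" using i iff[OF j(1)] by simp
    then show "i \<in> set (take k is)" using j by (auto simp: in_set_conv_nth)
  qed
  moreover have "{i \<in> support \<alpha>. ?P i} = {i \<in> {1..length \<alpha>}. ?P i}"
    using assms(2) unfolding support_def by auto
  ultimately have "set (take k is) = {i \<in> {1..length \<alpha>}. ?P i}" by simp
  then show thesis using that iff by simp
qed

section \<open>The upper transform as parking\<close>

lemma boundary_columns:
  "column_str (boundary_filling \<kappa> \<alpha>) =
    map (\<lambda>r. rev (strictify (map int (map (part \<kappa>) (key_column \<alpha> r)))))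
      [1..<Suc (Max (insert 0 (set \<alpha>)))]"
  unfolding column_str_def boundary_filling_def key_tableau_def
  by (simp add: rev_map comp_def)

text \<open>The content of a key tableau is the composition itself.\<close>

lemma key_tableau_inj:
  assumes "key_tableau \<gamma> = key_tableau \<delta>" "length \<gamma> = length \<delta>"
  shows "\<gamma> = \<delta>"
proof (rule nth_equalityI[OF assms(2)])
  fix k assume "k < length \<gamma>"
  then have "part \<gamma> (Suc k) = part \<delta> (Suc k)"
    using key_tableau_content[of "Suc k" \<gamma>] key_tableau_content[of "Suc k" \<delta>] assms by simp
  then show "\<gamma> ! k = \<delta> ! k" by (simp add: Defs.part_def)
qed

lemma key_column_boundary_sorted:
  assumes "box_partition n m \<kappa>" "length \<alpha> = n"
  shows "sorted_wrt (\<ge>) (map (part \<kappa>) (key_column \<alpha> r))"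
proof -
  have "set (key_column \<alpha> r) \<subseteq> {1..n}" unfolding key_column_def using assms(2) by auto
  moreover have "part \<kappa> p \<ge> part \<kappa> q" if "p < q" "p \<in> {1..n}" "q \<in> {1..n}" for p q
    using assms(1) that unfolding box_partition_def Defs.part_def
    by (auto simp: sorted_wrt_iff_nth_less)
  ultimately have "part \<kappa> p \<ge> part \<kappa> q"
    if "p \<in> set (key_column \<alpha> r)" "q \<in> set (key_column \<alpha> r)" "p < q" for p q
    using that by (meson subsetD)
  then show ?thesis unfolding sorted_wrt_map
    by (rule sorted_wrt_mono_rel[OF _ key_column_strict])
qed

text \<open>
  When the strictified columns are positive, no car fails, and for each
  \<open>r\<close> the positions of the parts at least \<open>r\<close> are the positions taken by a prefix of the
  parking order; being independent of the order of arrival, they form the strictified column.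
\<close>

lemma parking_run_key_tableau:
  assumes \<kappa>: "box_partition n m \<kappa>" and \<alpha>: "length \<alpha> = n"
    and pos: "\<forall>col \<in> set (column_str (boundary_filling \<kappa> \<alpha>)). \<forall>x \<in> set col. x > 0"
    and ord: "parking_order \<alpha> is"
  obtains \<gamma> where "parking_run m \<kappa> \<alpha> is = Some \<gamma>" "length \<gamma> = m"
    "map (map int) (key_tableau \<gamma>) = column_str (boundary_filling \<kappa> \<alpha>)"
proof -
  let ?M = "Max (insert 0 (set \<alpha>))"
  let ?col = "\<lambda>r. map (part \<kappa>) (key_column \<alpha> r)"
  have dist: "distinct is" and supp: "set is = support \<alpha>"
    using ord unfolding parking_order_def by auto
  have colpos: "\<forall>y \<in> set (strictify (map int (?col r))). y > 0" if "r \<in> {1..?M}" for r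
    using pos that unfolding boundary_columns by (auto simp del: upt_Suc)
  have sorted: "sorted_wrt (\<ge>) (?col r)" for r
    using key_column_boundary_sorted[OF \<kappa> \<alpha>] .
  have keyset: "set (key_column \<alpha> r) = {i \<in> {1..length \<alpha>}. part \<alpha> i \<ge> r}"
    and keydist: "distinct (key_column \<alpha> r)" for r
    unfolding key_column_def by auto
  \<comment> \<open>The first column contains all rows that park, so its positivity alone excludes failure.\<close>
  have "park_positions \<kappa> {} is \<noteq> None"
  proof (cases "is = []")
    case False
    then obtain i where i: "i \<in> support \<alpha>" using supp by (metis hd_in_set)
    then have "part \<alpha> i \<in> insert 0 (set \<alpha>)"
      using part_in_set[of i \<alpha>] unfolding support_def by simp
    then have "part \<alpha> i \<le> ?M" by (intro Max_ge) auto
    then have M: "1 \<in> {1..?M}" using i unfolding support_def by auto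
    have "set (key_column \<alpha> 1) = set is" unfolding keyset supp support_def by auto
    then have "fold park (map (part \<kappa>) is) {} = fold park (?col 1) {}"
      using dist keydist by (intro fold_park_order_independent) auto
    moreover have "0 \<notin> fold park (?col 1) {}"
    proof
      assume "0 \<in> fold park (?col 1) {}"
      then have "int 0 \<in> set (strictify (map int (?col 1)))"
        using strictify_eq_park[OF sorted colpos[OF M]] by blast
      then show False using colpos[OF M] by fastforce
    qed
    ultimately show ?thesis by (intro park_positions_succeeds) simp
  qed simp
  then obtain qs where qs: "park_positions \<kappa> {} is = Some qs" by blast
  note run = park_positions_Some[OF qs]
  define \<gamma> where "\<gamma> = place_parts m (zip qs (map (part \<alpha>) is))"
  have len: "length \<gamma> = m" unfolding \<gamma>_def place_parts_def by simp
  have inbox: "q \<in> {1..m}" if q: "q \<in> set qs" for q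
  proof -
    obtain i where i: "i \<in> support \<alpha>" "q \<in> {1..part \<kappa> i}"
      using bspec[OF run(5) q] unfolding supp by blast
    then have "part \<kappa> i \<in> set \<kappa>"
      using \<kappa> \<alpha> unfolding support_def box_partition_def by (intro part_in_set) auto
    then show ?thesis using \<kappa> i(2) unfolding box_partition_def by fastforce
  qed
  have hit: "part \<gamma> (qs ! j) = part \<alpha> (is ! j)" if "j < length is" for j
  proof -
    have j: "j < length qs" using that run(1) by simp
    then have "qs ! j \<in> {1..m}" by (intro inbox nth_mem)
    then show ?thesis
      unfolding \<gamma>_def using run(1,3) j
      by (subst part_place_parts(2)[where k = j and m = m]) simp_all
  qed
  have miss: "part \<gamma> q = 0" if "q \<in> {1..m}" "q \<notin> set qs" for q
    unfolding \<gamma>_def using run(1,3) that by (subst part_place_parts(1)[where m = m]) simp_all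
  have suppg: "support \<gamma> \<subseteq> set qs"
  proof
    fix q assume "q \<in> support \<gamma>"
    then have "q \<in> {1..m}" "part \<gamma> q > 0" using len unfolding support_def by simp_all
    then show "q \<in> set qs" using miss[of q] by fastforce
  qed
  have image: "part \<gamma> ` set qs = part \<alpha> ` set is"
  proof -
    have "map (part \<gamma>) qs = map (part \<alpha>) is"
      using hit run(1) by (intro nth_equalityI) auto
    then show ?thesis by (metis list.set_map)
  qed
  have "support \<gamma> = set qs"
  proof (intro equalityI suppg subsetI)
    fix q assume q: "q \<in> set qs"
    then have "part \<gamma> q \<in> part \<alpha> ` support \<alpha>" using image supp by blast
    then show "q \<in> support \<gamma>" using inbox[OF q] len unfolding support_def by auto
  qed
  \<comment> \<open>The outcome permutes the nonzero parts, so both tableaux have equally many columns.\<close>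
  then have M: "insert 0 (set \<gamma>) = insert 0 (set \<alpha>)"
    using image supp unfolding insert_zero_set_conv_support[of \<gamma>]
      insert_zero_set_conv_support[of \<alpha>] by simp
  have column: "map int (key_column \<gamma> r) = rev (strictify (map int (?col r)))"
    if r: "r \<in> {1..?M}" for r
  proof -
    obtain k where k: "set (take k is) = {i \<in> {1..length \<alpha>}. part \<alpha> i \<ge> r}"
      "\<And>j. j < length is \<Longrightarrow> part \<alpha> (is ! j) \<ge> r \<longleftrightarrow> j < k"
      using parking_order_prefix[OF ord, of r] r by auto
    have "fold park (?col r) {} = fold park (map (part \<kappa>) (take k is)) {}"
      using dist keydist keyset k(1) by (intro fold_park_order_independent) auto
    also have "\<dots> = set (take k qs)"
      using park_positions_Some(2)[OF park_positions_take[OF qs]] by simp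
    also have "\<dots> = {q \<in> {1..length \<gamma>}. part \<gamma> q \<ge> r}"
    proof (intro equalityI subsetI)
      fix q assume "q \<in> set (take k qs)"
      then obtain j where "j < k" "j < length is" "q = qs ! j"
        using run(1) by (auto simp: in_set_conv_nth)
      then show "q \<in> {q \<in> {1..length \<gamma>}. part \<gamma> q \<ge> r}"
        using hit k(2) inbox[of q] len run(1) by auto
    next
      fix q assume q: "q \<in> {q \<in> {1..length \<gamma>}. part \<gamma> q \<ge> r}"
      then have "q \<in> set qs" using miss[of q] r len by auto
      then obtain j where "j < length is" "q = qs ! j"
        using run(1) by (auto simp: in_set_conv_nth)
      moreover from this have "j < k" using q hit k(2) by auto
      ultimately show "q \<in> set (take k qs)"
        using run(1) by (auto simp: in_set_conv_nth)
    qed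
    finally show ?thesis
      unfolding key_column_def[of \<gamma>]
      using rev_strictify_eq_sorted_list[OF sorted colpos[OF r]] by simp
  qed
  have "map (map int) (key_tableau \<gamma>) = column_str (boundary_filling \<kappa> \<alpha>)"
    unfolding boundary_columns key_tableau_def M map_map
    by (rule map_cong[OF refl]) (use column in \<open>auto simp del: upt_Suc\<close>)
  then show thesis using that[of \<gamma>] len qs unfolding parking_run_def \<gamma>_def by simp
qed

lemma upper_transform_eq_parking:
  assumes \<kappa>: "box_partition n m \<kappa>" and "\<alpha> \<in> Comp n m \<kappa>"
  obtains \<gamma> where "length \<gamma> = m" "upper_transform m \<kappa> \<alpha> = Some \<gamma>"
    "parking_outcomes m \<kappa> \<alpha> = {Some \<gamma>}"
proof -
  let ?T = "column_str (boundary_filling \<kappa> \<alpha>)"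
  have \<alpha>: "length \<alpha> = n" and pos: "\<forall>col \<in> set ?T. \<forall>x \<in> set col. x > 0"
    using assms(2) unfolding Comp_def upper_transform_def by (auto split: if_splits)
  have inj: "\<gamma> = \<delta>" if "length \<gamma> = m" "length \<delta> = m"
    "map (map int) (key_tableau \<gamma>) = ?T" "map (map int) (key_tableau \<delta>) = ?T" for \<gamma> \<delta>
  proof (rule key_tableau_inj)
    have "inj (map (map int))" by (intro inj_mapI inj_of_nat)
    moreover have "map (map int) (key_tableau \<gamma>) = map (map int) (key_tableau \<delta>)"
      using that(3,4) by simp
    ultimately show "key_tableau \<gamma> = key_tableau \<delta>" by (rule injD)
  qed (use that in simp)
  obtain is0 where "parking_order \<alpha> is0" using parking_order_exists by blast
  then obtain \<gamma> where \<gamma>: "parking_run m \<kappa> \<alpha> is0 = Some \<gamma>" "length \<gamma> = m"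
    "map (map int) (key_tableau \<gamma>) = ?T"
    using parking_run_key_tableau[OF \<kappa> \<alpha> pos] by blast
  have all: "parking_run m \<kappa> \<alpha> is = Some \<gamma>" if "parking_order \<alpha> is" for "is"
    using parking_run_key_tableau[OF \<kappa> \<alpha> pos that] inj[OF _ \<gamma>(2) _ \<gamma>(3)] by metis
  have "upper_transform m \<kappa> \<alpha> = Some (THE \<gamma>. length \<gamma> = m \<and> map (map int) (key_tableau \<gamma>) = ?T)"
    unfolding upper_transform_def using pos by simp
  also have "(THE \<gamma>. length \<gamma> = m \<and> map (map int) (key_tableau \<gamma>) = ?T) = \<gamma>"
    using \<gamma> inj by (intro the_equality) auto
  finally have "upper_transform m \<kappa> \<alpha> = Some \<gamma>" .
  moreover have "parking_outcomes m \<kappa> \<alpha> = {Some \<gamma>}"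
    unfolding parking_outcomes_def using all \<open>parking_order \<alpha> is0\<close> by force
  ultimately show thesis using that \<gamma>(2) by blast
qed

section \<open>The lower transform\<close>

lemma box_partition_complement:
  "box_partition n m \<mu> \<Longrightarrow> box_partition n m (box_complement m \<mu>)"
  unfolding box_partition_def box_complement_def
  by (auto simp: sorted_wrt_map sorted_wrt_rev elim!: sorted_wrt_mono_rel[rotated])

theorem corollary51:
  fixes n m :: nat and \<mu> \<beta> :: "nat list"
  assumes "box_partition n m \<mu>" and "length \<beta> = n"
  shows "(lower_transform m \<mu> \<beta> \<noteq> None \<longleftrightarrow> rev \<beta> \<in> Comp n m (box_complement m \<mu>)) \<and>
    (rev \<beta> \<in> Comp n m (box_complement m \<mu>) \<longrightarrow>
      (\<exists>\<gamma>. length \<gamma> = m \<and>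
           upper_transform m (box_complement m \<mu>) (rev \<beta>) = Some \<gamma> \<and>
           parking_outcomes m (box_complement m \<mu>) (rev \<beta>) = {Some \<gamma>} \<and>
           lower_transform m \<mu> \<beta> = Some (rev \<gamma>)))"
proof (intro conjI impI)
  show "lower_transform m \<mu> \<beta> \<noteq> None \<longleftrightarrow> rev \<beta> \<in> Comp n m (box_complement m \<mu>)"
    unfolding lower_transform_def Comp_def using assms(2) by simp
  assume "rev \<beta> \<in> Comp n m (box_complement m \<mu>)"
  then obtain \<gamma> where "length \<gamma> = m"
    "upper_transform m (box_complement m \<mu>) (rev \<beta>) = Some \<gamma>"
    "parking_outcomes m (box_complement m \<mu>) (rev \<beta>) = {Some \<gamma>}"
    using upper_transform_eq_parking[OF box_partition_complement[OF assms(1)]] by blast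
  then show "\<exists>\<gamma>. length \<gamma> = m \<and>
      upper_transform m (box_complement m \<mu>) (rev \<beta>) = Some \<gamma> \<and>
      parking_outcomes m (box_complement m \<mu>) (rev \<beta>) = {Some \<gamma>} \<and>
      lower_transform m \<mu> \<beta> = Some (rev \<gamma>)"
    unfolding lower_transform_def by simp
qed

end
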